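(* Assume that a class of languages $\mathcal{C}$ satisfies the following properties: (a) if $L\subseteq\Sigma^*$ is a language in the class $\mathcal{C}$, then $L\otimes\Sigma^*=\{u\otimes v \mid u\in L, v\in\Sigma^*\}$ is in the class $\mathcal{C}$; (b) if $R$ is a regular language and $L$ is in the class $\mathcal{C}$, then $R\cap L$ is in the class $\mathcal{C}$. Then, for a given $\mathcal{C}$-Cayley p.f. linear-time computable group $G$, the tuple $(G,S,\Sigma)$ is $\mathcal{C}$-graph automatic for some finite alphabet $\Sigma$ and every (finite) symmetric generating set $S$ of $G$.
   Context: Convolution: for a finite alphabet $\Sigma$ and a symbol $\diamond\notin\Sigma$ put $\Sigma_\diamond=\Sigma\cup\{\diamond\}$. For $u_1,u_2\in\Sigma^*$, $u_1\otimes u_2$ is the string of length $\max\{|u_1|,|u_2|\}$ over $\Sigma_\diamond^2$ whose $i$th symbol is the pair $(\sigma_i^1,\sigma_i^2)$, where $\sigma_i^k$ is the $i$th symbol of $u_k$ if $i\leqslant|u_k|$ and $\diamond$ otherwise. $\mathcal{C}$-graph automatic: let $G$ be a group, $S$ a symmetric generating set ($s\in S$ implies $s^{-1}\in S$) and $\Sigma$ a finite alphabet. The tuple $(G,S,\Sigma)$ is $\mathcal{C}$-graph automatic if there is a bijection $\psi:L\to G$ with $L\subseteq\Sigma^*$ in the class $\mathcal{C}$ such that for every $s\in S$ the language $L_s=\{u\otimes v\mid u,v\in L,\ \psi(u)s=\psi(v)\}$ is in the class $\mathcal{C}$. Position-faithful one-tape Turing machine: a Turing machine with one semi-infinite tape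 (infinite in one direction only) whose left-most cell contains a special symbol $\boxplus$ which occurs only there and cannot be modified. On input $x\in\Sigma^*$ the initial tape content is $\boxplus x\boxdot^\infty$, where $\boxdot$ is a special blank symbol and $\Sigma\cap\{\boxplus,\boxdot\}=\varnothing$, and the head starts at $\boxplus$. The machine computes $f:\Sigma^*\to\Sigma^*$ if on every input $x\in\Sigma^*$ it eventually reaches an accepting state and halts with the tape having prefix $\boxplus f(x)\boxdot$ (no restriction on the tape content after this first $\boxdot$). A function $f:\Sigma^*\to\Sigma^*$ is position-faithful (p.f.) linear-time computable if it is computed by a deterministic position-faithful one-tape Turing machine in time linear in the input length. Let $G$ be a finitely generated group, $T=\{t_1,\dots,t_n\}\subset G$ a finite set of semigroup generators (every $g\in G$ is a product of elements of $T$), and $\mathcal{C}$ a nonempty class of languages. $G$ is $\mathcal{C}$-Cayley p.f. linear-time computable if there exist a language $L\subseteq\Sigma^*$ in the class $\mathcal{C}$ over a finite alphabet $\Sigma$, a bijection $\psi:L\to G$ and p.f. linear-time computable functions $f_i:\Sigma^*\to\Sigma^*$, $i=1,\dots,n$, with $f_i(L)\subseteq L$ and $\psi(f_i(w))=\psi(w)t_i$ for all $w\in L$. This notion does not depend on the choice of $T$. Standing assumption: $\mathcal{C}$ is closed under a change of symbols in the alphabet: if $\xi:\Sigma\to\Sigma'$ is a bijection between finite alphabets and $L\subseteq\Sigma^*$ is in $\mathcal{C}$, then the image of $L$ under the homomorphism induced by $\xi$ is in $\mathcal{C}$. *)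

theory Defs
  imports "HOL-Algebra.Generated_Groups"
begin

text \<open>
  All alphabets are finite subsets of one infinite type of symbols that is closed under forming
  the pairs in $\Sigma_\diamond^2$. The padding symbol $\diamond$ is represented by
  \<^const>\<open>None\<close>, so that it never belongs to an alphabet.
\<close>

datatype letter = Atom nat | Conv "letter option" "letter option"

definition padded_nth :: "letter list \<Rightarrow> nat \<Rightarrow> letter option" where
  "padded_nth u i = (if i < length u then Some (u ! i) else None)"

definition convolution :: "letter list \<Rightarrow> letter list \<Rightarrow> letter list" where
  "convolution u v =
     map (\<lambda>i. Conv (padded_nth u i) (padded_nth v i)) [0..<max (length u) (length v)]"


text \<open>
  A class of languages is a set of languages, each of them over some finite alphabet. The last
  conjunct is closure under a change of symbols.
\<close>

definition language_class :: "letter list set set \<Rightarrow> bool" where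
  "language_class \<C> \<longleftrightarrow>
     \<C> \<noteq> {} \<and>
     (\<forall>L\<in>\<C>. \<exists>\<Sigma>. finite \<Sigma> \<and> L \<subseteq> lists \<Sigma>) \<and>
     (\<forall>\<Sigma> \<Sigma>' \<xi> L. finite \<Sigma> \<and> finite \<Sigma>' \<and> bij_betw \<xi> \<Sigma> \<Sigma>' \<and> L \<subseteq> lists \<Sigma> \<and> L \<in> \<C>
        \<longrightarrow> map \<xi> ` L \<in> \<C>)"

definition regular_language :: "letter list set \<Rightarrow> bool" where
  "regular_language R \<longleftrightarrow>
     (\<exists>\<Sigma> (Q :: nat set) q\<^sub>0 \<delta> F.
        finite \<Sigma> \<and> finite Q \<and> q\<^sub>0 \<in> Q \<and> F \<subseteq> Q \<and> (\<forall>q\<in>Q. \<forall>a\<in>\<Sigma>. \<delta> q a \<in> Q) \<and>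
        R = {w \<in> lists \<Sigma>. foldl \<delta> q\<^sub>0 w \<in> F})"


datatype tape_symbol = Left_End | Blank | Letter letter

datatype move = Move_Left | Stay | Move_Right

text \<open>
  A transition function returning \<^const>\<open>None\<close> means that the machine halts.
\<close>

record pf_tm =
  states :: "nat set"
  start :: nat
  accepting :: "nat set"
  tape_alphabet :: "tape_symbol set"
  trans :: "nat \<Rightarrow> tape_symbol \<Rightarrow> (nat \<times> tape_symbol \<times> move) option"

definition pf_tm_wf :: "letter set \<Rightarrow> pf_tm \<Rightarrow> bool" where
  "pf_tm_wf \<Sigma> M \<longleftrightarrow>
     finite (states M) \<and> start M \<in> states M \<and> accepting M \<subseteq> states M \<and>
     finite (tape_alphabet M) \<and>
     {Left_End, Blank} \<union> Letter ` \<Sigma> \<subseteq> tape_alphabet M \<and>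
     (\<forall>q\<in>states M. \<forall>a\<in>tape_alphabet M. \<forall>q' b m. trans M q a = Some (q', b, m) \<longrightarrow>
        q' \<in> states M \<and> b \<in> tape_alphabet M \<and>
        (b = Left_End \<longleftrightarrow> a = Left_End) \<and>
        (a = Left_End \<longrightarrow> m \<noteq> Move_Left))"

text \<open>
  A configuration consists of the state, the tape content and the head position; cell
  $0$ is the left-most cell.
\<close>

type_synonym config = "nat \<times> (nat \<Rightarrow> tape_symbol) \<times> nat"

fun move_head :: "move \<Rightarrow> nat \<Rightarrow> nat" where
  "move_head Move_Left h = h - 1"
| "move_head Stay h = h"
| "move_head Move_Right h = Suc h"

definition tm_step :: "pf_tm \<Rightarrow> (config \<times> config) set" where
  "tm_step M = {((q, tp, h), (q', tp(h := b), move_head m h)) | q tp h q' b m.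
                  trans M q (tp h) = Some (q', b, m)}"

definition initial_tape :: "letter list \<Rightarrow> nat \<Rightarrow> tape_symbol" where
  "initial_tape x i =
     (if i = 0 then Left_End else if i \<le> length x then Letter (x ! (i - 1)) else Blank)"

definition accepts_with_output :: "pf_tm \<Rightarrow> letter list \<Rightarrow> nat \<Rightarrow> letter list \<Rightarrow> bool" where
  "accepts_with_output M x t y \<longleftrightarrow>
     (\<exists>q tp h. ((start M, initial_tape x, 0), (q, tp, h)) \<in> tm_step M ^^ t \<and>
        trans M q (tp h) = None \<and> q \<in> accepting M \<and>
        map tp [0..<length y + 2] = Left_End # map Letter y @ [Blank])"

text \<open>
  The bound is $c(|x|+1)$ rather than $c|x|$ so that the empty input does not force the machine
  to halt immediately.
\<close>

definition pf_linear_time_computable ::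
    "letter set \<Rightarrow> (letter list \<Rightarrow> letter list) \<Rightarrow> bool" where
  "pf_linear_time_computable \<Sigma> f \<longleftrightarrow>
     f \<in> lists \<Sigma> \<rightarrow> lists \<Sigma> \<and>
     (\<exists>M c. pf_tm_wf \<Sigma> M \<and>
        (\<forall>x\<in>lists \<Sigma>. \<exists>t \<le> c * (length x + 1). accepts_with_output M x t (f x)))"


definition semigroup_generators :: "('g, 'b) monoid_scheme \<Rightarrow> 'g set \<Rightarrow> bool" where
  "semigroup_generators G T \<longleftrightarrow>
     T \<subseteq> carrier G \<and>
     (\<forall>g\<in>carrier G. \<exists>ts. ts \<noteq> [] \<and> set ts \<subseteq> T \<and> g = foldr (mult G) ts \<one>\<^bsub>G\<^esub>)"

definition cayley_pf_linear_time_computable ::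
    "letter list set set \<Rightarrow> ('g, 'b) monoid_scheme \<Rightarrow> bool" where
  "cayley_pf_linear_time_computable \<C> G \<longleftrightarrow>
     (\<exists>T. finite T \<and> semigroup_generators G T \<and>
       (\<exists>\<Sigma> L \<psi> f. finite \<Sigma> \<and> L \<subseteq> lists \<Sigma> \<and> L \<in> \<C> \<and> bij_betw \<psi> L (carrier G) \<and>
          (\<forall>t\<in>T. pf_linear_time_computable \<Sigma> (f t) \<and> f t ` L \<subseteq> L \<and>
             (\<forall>w\<in>L. \<psi> (f t w) = \<psi> w \<otimes>\<^bsub>G\<^esub> t))))"

definition symmetric_generating_set :: "('g, 'b) monoid_scheme \<Rightarrow> 'g set \<Rightarrow> bool" where
  "symmetric_generating_set G S \<longleftrightarrow>
     S \<subseteq> carrier G \<and> generate G S = carrier G \<and> (\<forall>s\<in>S. inv\<^bsub>G\<^esub> s \<in> S)"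

definition graph_automatic ::
    "letter list set set \<Rightarrow> ('g, 'b) monoid_scheme \<Rightarrow> 'g set \<Rightarrow> letter set \<Rightarrow> bool" where
  "graph_automatic \<C> G S \<Sigma> \<longleftrightarrow>
     group G \<and> symmetric_generating_set G S \<and> finite \<Sigma> \<and>
     (\<exists>L \<psi>. L \<subseteq> lists \<Sigma> \<and> L \<in> \<C> \<and> bij_betw \<psi> L (carrier G) \<and>
        (\<forall>s\<in>S. {convolution u v | u v. u \<in> L \<and> v \<in> L \<and> \<psi> u \<otimes>\<^bsub>G\<^esub> s = \<psi> v} \<in> \<C>))"

end

theory Submission imports Defs begin

text \<open>
  Right multiplication by a group element $s$ acts on the normal forms in $L$ as a function $g$,
  a composition of the given position-faithful linear-time functions. As $\psi$ is injective,
  the language of $s$-edges is the set of all $u \otimes g(u)$ with $u \in L$, that is, the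
  intersection of $L \otimes \Sigma^*$ with $\{u \otimes g(u) \mid u \in \Sigma^*\}$. By the two
  closure properties of $\mathcal{C}$ it remains to see that the latter set is regular.

  The link between machines and automata is the operation of splicing: cut $u$ after $i$ letters
  and $v$ after $j$ letters, and join the head of $u$ to the tail of $v$. Call a function finitely
  spliceable if finitely many labels can be attached to all cuts $(u, i)$ such that the function
  commutes with splicing whenever the two cuts have the same label. Such functions are closed
  under composition (\<open>finitely_spliceable_compose\<close>). They have a regular graph
  (\<open>regular_graph_if_finitely_spliceable\<close>), because a prefix of $u \otimes f(u)$ influences its
  possible continuations only through the set of labels that the cut at its end can carry,
  refined by whether $u$ and $f(u)$ end before it. So the graph has finitely many left derivatives.

  A function computed by a one-tape machine in linear time is finitely spliceable
  (\<open>finitely_spliceable_if_pf_linear_time_computable\<close>). The label of a cut consists of the crossing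
  sequence of the run at the corresponding tape boundary, that is, the list of states in which
  the head crosses it, and of two bits that say whether the input and the output end before the cut.
  Runs with equal crossing sequences can be glued together (\<open>run_splice\<close>), and since the output is
  written from the left end of the tape, it is glued at the same place as the input. Finiteness
  of the set of labels is Hennie's theorem (\<open>crossings_bounded_if_linear_time\<close>): the crossing
  sequences of a linear-time one-tape machine have bounded length.
\<close>

section \<open>Splicing words and regularity\<close>

text \<open>
  One direction of the Myhill--Nerode theorem: the left derivatives of the language are the
  states of a deterministic automaton that accepts it.
\<close>

lemma regular_if_finite_derivatives:
  assumes "finite A" "W \<subseteq> lists A" and fin: "finite ((\<lambda>w. {z. w @ z \<in> W}) ` lists A)"
  shows "regular_language W"
proof -
  define D where "D w = {z. w @ z \<in> W}" for w
  obtain e :: "letter list set \<Rightarrow> nat" where inj: "inj_on e (D ` lists A)"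
    using finite_imp_inj_to_nat_seg[OF fin] unfolding D_def by metis
  define \<delta> where "\<delta> q a = e {z. a # z \<in> inv_into (D ` lists A) e q}" for q a
  have \<delta>: "\<delta> (e (D w)) a = e (D (w @ [a]))" if "w \<in> lists A" for w a
    using that inj by (simp add: \<delta>_def) (simp add: D_def)
  have run: "foldl \<delta> (e (D [])) w = e (D w)" if "w \<in> lists A" for w
    using that by (induction w rule: rev_induct) (auto simp: \<delta>)
  let ?F = "e ` {X \<in> D ` lists A. [] \<in> X}"
  have acc: "e (D w) \<in> ?F \<longleftrightarrow> w \<in> W" if "w \<in> lists A" for w
  proof -
    have "e (D w) \<in> ?F \<longleftrightarrow> [] \<in> D w"
      using that inj by (force simp: inj_on_def)
    then show ?thesis by (simp add: D_def)
  qed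
  have "W = {w \<in> lists A. foldl \<delta> (e (D [])) w \<in> ?F}"
  proof (intro subset_antisym subsetI CollectI conjI)
    fix w assume "w \<in> W"
    then show "w \<in> lists A" using assms(2) by blast
    then show "foldl \<delta> (e (D [])) w \<in> ?F"
      using acc \<open>w \<in> W\<close> by (simp only: run)
  next
    fix w assume "w \<in> {w \<in> lists A. foldl \<delta> (e (D [])) w \<in> ?F}"
    then have "w \<in> lists A" "foldl \<delta> (e (D [])) w \<in> ?F" by blast+
    then show "w \<in> W" using acc by (simp only: run)
  qed
  moreover have "finite (e ` D ` lists A)"
    using fin by (simp add: D_def)
  moreover have "\<forall>q\<in>e ` D ` lists A. \<forall>a\<in>A. \<delta> q a \<in> e ` D ` lists A"
    by (auto simp: \<delta> simp del: in_lists_conv_set append_in_lists_conv intro!: imageI)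
  ultimately show ?thesis
    unfolding regular_language_def using assms(1)
    by (intro exI[of _ A] exI[of _ "e ` D ` lists A"] exI[of _ "e (D [])"] exI[of _ \<delta>] exI[of _ ?F])
      auto
qed

text \<open>
  The value $p\,u\,i$ is the label of the cut of $u$ after $i$ letters. The cut may lie beyond the
  end of $u$, which happens when $u$ is shorter than the word with which it is convolved. Natural
  numbers serve as labels because the type of $p$ has to be fixed inside the definition.
\<close>

definition finitely_spliceable :: "letter set \<Rightarrow> (letter list \<Rightarrow> letter list) \<Rightarrow> bool" where
  "finitely_spliceable \<Sigma> f \<longleftrightarrow>
     (\<exists>p :: letter list \<Rightarrow> nat \<Rightarrow> nat.
        finite {p u i | u i. u \<in> lists \<Sigma>} \<and>
        (\<forall>u\<in>lists \<Sigma>. \<forall>v\<in>lists \<Sigma>. \<forall>i j. p u i = p v j \<longrightarrow>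
           f (take i u @ drop j v) = take i (f u) @ drop j (f v)))"

lemma finitely_spliceableI:
  fixes p :: "letter list \<Rightarrow> nat \<Rightarrow> 'k"
  assumes "finite P" and "\<And>u i. u \<in> lists \<Sigma> \<Longrightarrow> p u i \<in> P"
    and "\<And>u v i j. \<lbrakk>u \<in> lists \<Sigma>; v \<in> lists \<Sigma>; p u i = p v j\<rbrakk> \<Longrightarrow>
           f (take i u @ drop j v) = take i (f u) @ drop j (f v)"
  shows "finitely_spliceable \<Sigma> f"
proof -
  obtain e :: "'k \<Rightarrow> nat" where inj: "inj_on e P"
    using finite_imp_inj_to_nat_seg[OF assms(1)] by metis
  have "finite {e (p u i) | u i. u \<in> lists \<Sigma>}"
    by (rule finite_subset[OF _ finite_imageI[OF assms(1), of e]]) (use assms(2) in auto)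
  then show ?thesis
    unfolding finitely_spliceable_def
    by (intro exI[of _ "\<lambda>u i. e (p u i)"] conjI ballI allI impI)
      (auto simp del: in_lists_conv_set intro!: assms(3) inj_onD[OF inj] assms(2))
qed

lemma finitely_spliceable_id: "finitely_spliceable \<Sigma> (\<lambda>w. w)"
  by (rule finitely_spliceableI[of "{()}" _ "\<lambda>_ _. ()"]) auto

text \<open>
  A cut of $w$ is labelled by its label for $f$ and the label for $g$ of the cut of $f(w)$ at the
  same position. If these agree, $f$ maps the spliced word to a splice of its values, to which the
  property of $g$ applies.
\<close>

lemma finitely_spliceable_compose:
  assumes "finitely_spliceable \<Sigma> f" "finitely_spliceable \<Sigma> g" and f: "f \<in> lists \<Sigma> \<rightarrow> lists \<Sigma>"
  shows "finitely_spliceable \<Sigma> (\<lambda>w. g (f w))"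
proof -
  obtain p :: "letter list \<Rightarrow> nat \<Rightarrow> nat" where
    p: "finite {p u i | u i. u \<in> lists \<Sigma>}"
       "\<forall>u\<in>lists \<Sigma>. \<forall>v\<in>lists \<Sigma>. \<forall>i j. p u i = p v j \<longrightarrow>
          f (take i u @ drop j v) = take i (f u) @ drop j (f v)"
    using assms(1) unfolding finitely_spliceable_def by blast
  obtain q :: "letter list \<Rightarrow> nat \<Rightarrow> nat" where
    q: "finite {q u i | u i. u \<in> lists \<Sigma>}"
       "\<forall>u\<in>lists \<Sigma>. \<forall>v\<in>lists \<Sigma>. \<forall>i j. q u i = q v j \<longrightarrow>
          g (take i u @ drop j v) = take i (g u) @ drop j (g v)"
    using assms(2) unfolding finitely_spliceable_def by blast
  have fin: "finite ({p u i | u i. u \<in> lists \<Sigma>} \<times> {q u i | u i. u \<in> lists \<Sigma>})"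
    by (rule finite_cartesian_product[OF p(1) q(1)])
  have f': "f u \<in> lists \<Sigma>" if "u \<in> lists \<Sigma>" for u
    using f that by blast
  show ?thesis
  proof (rule finitely_spliceableI[OF fin, of _ "\<lambda>u i. (p u i, q (f u) i)"])
    fix u i assume "u \<in> lists \<Sigma>"
    then show "(p u i, q (f u) i) \<in> {p u i | u i. u \<in> lists \<Sigma>} \<times> {q u i | u i. u \<in> lists \<Sigma>}"
      using f' by blast
  next
    fix u v i j
    assume "u \<in> lists \<Sigma>" "v \<in> lists \<Sigma>" "(p u i, q (f u) i) = (p v j, q (f v) j)"
    then show "g (f (take i u @ drop j v)) = take i (g (f u)) @ drop j (g (f v))"
      by (simp add: p(2)[rule_format] q(2)[rule_format] f' del: in_lists_conv_set)
  qed
qed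

lemma length_convolution [simp]: "length (convolution u v) = max (length u) (length v)"
  by (simp add: convolution_def)

lemma nth_convolution [simp]:
  "k < max (length u) (length v) \<Longrightarrow>
     convolution u v ! k = Conv (padded_nth u k) (padded_nth v k)"
  by (simp add: convolution_def)

lemma padded_nth_eqI:
  assumes "\<And>k. padded_nth u k = padded_nth v k"
  shows "u = v"
proof (rule nth_equalityI)
  have *: "k < length u \<longleftrightarrow> k < length v" for k
    using assms[of k] by (auto simp: padded_nth_def split: if_splits)
  show "length u = length v"
    using *[of "length u"] *[of "length v"] by simp
  show "u ! k = v ! k" if "k < length u" for k
    using assms[of k] that * by (simp add: padded_nth_def)
qed

lemma convolution_inject:
  assumes "convolution u v = convolution u' v'"
  shows "u = u' \<and> v = v'"
proof -
  let ?m = "max (length u) (length v)"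
  have len: "?m = max (length u') (length v')"
    using arg_cong[OF assms, of length] by simp
  have eq: "padded_nth u k = padded_nth u' k \<and> padded_nth v k = padded_nth v' k" for k
  proof (cases "k < ?m")
    case True
    have "convolution u v ! k = convolution u' v' ! k"
      by (simp only: assms)
    moreover have "convolution u' v' ! k = Conv (padded_nth u' k) (padded_nth v' k)"
      using True unfolding len by (rule nth_convolution)
    ultimately show ?thesis
      using True by (simp del: max_less_iff_conj less_max_iff_disj)
  next
    case False
    then have "\<not> k < length u" "\<not> k < length v" "\<not> k < length u'" "\<not> k < length v'"
      using len by auto
    then show ?thesis by (simp add: padded_nth_def)
  qed
  then show ?thesis by (metis padded_nth_eqI)
qed

lemma padded_nth_splice:
  assumes "length u < i \<longleftrightarrow> length u' < j"
  shows "padded_nth (take i u @ drop j u') k =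
           (if k < i then padded_nth u k else padded_nth u' (k - i + j))"
  using assms by (auto simp: padded_nth_def nth_append min_def add.commute)

text \<open>
  Joining a word that ends before the cut to a nonempty tail would close a gap of padding symbols
  and shift letters. The first two conditions exclude this.
\<close>

lemma convolution_splice:
  assumes "length u < i \<longleftrightarrow> length u' < j" "length v < i \<longleftrightarrow> length v' < j"
    and "i \<le> max (length u) (length v)" "j \<le> max (length u') (length v')"
  shows "convolution (take i u @ drop j u') (take i v @ drop j v') =
           take i (convolution u v) @ drop j (convolution u' v')"
proof (rule nth_equalityI)
  have len: "length (convolution (take i u @ drop j u') (take i v @ drop j v')) =
        i + (max (length u') (length v') - j)"
    using assms by (auto simp: max_def min_def)
  then show "length (convolution (take i u @ drop j u') (take i v @ drop j v')) =
        length (take i (convolution u v) @ drop j (convolution u' v'))"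
    using assms(3) by (simp only: length_append length_take length_drop length_convolution min_absorb2)
  fix k assume k0: "k < length (convolution (take i u @ drop j u') (take i v @ drop j v'))"
  then have k: "k < max (length (take i u @ drop j u')) (length (take i v @ drop j v'))"
    by (simp only: length_convolution)
  have k': "k < i + (max (length u') (length v') - j)"
    using k0 by (simp only: len)
  show "convolution (take i u @ drop j u') (take i v @ drop j v') ! k =
        (take i (convolution u v) @ drop j (convolution u' v')) ! k"
    unfolding nth_convolution[OF k] padded_nth_splice[OF assms(1)] padded_nth_splice[OF assms(2)]
  proof (cases "k < i")
    case True
    then have "k < max (length u) (length v)" using assms(3) by simp
    then show "Conv (if k < i then padded_nth u k else padded_nth u' (k - i + j))
      (if k < i then padded_nth v k else padded_nth v' (k - i + j)) =
      (take i (convolution u v) @ drop j (convolution u' v')) ! k"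
      using True assms(3) by (simp add: nth_append del: less_max_iff_disj)
  next
    case False
    then have l: "k - i + j < max (length u') (length v')" using k' by linarith
    have "(take i (convolution u v) @ drop j (convolution u' v')) ! k =
        convolution u' v' ! (k - i + j)"
      using False assms(3,4) by (simp add: nth_append min_absorb2 add.commute)
    then show "Conv (if k < i then padded_nth u k else padded_nth u' (k - i + j))
      (if k < i then padded_nth v k else padded_nth v' (k - i + j)) =
      (take i (convolution u v) @ drop j (convolution u' v')) ! k"
      using False nth_convolution[OF l] by simp
  qed
qed

lemma convolution_in_lists:
  assumes "u \<in> lists \<Sigma>" "v \<in> lists \<Sigma>"
  shows "convolution u v \<in>
    lists ((\<lambda>(a, b). Conv a b) ` (insert None (Some ` \<Sigma>) \<times> insert None (Some ` \<Sigma>)))"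
proof -
  have padded: "padded_nth w k \<in> insert None (Some ` \<Sigma>)" if "w \<in> lists \<Sigma>" for w k
    using that by (auto simp: padded_nth_def)
  show ?thesis
    unfolding convolution_def in_lists_conv_set set_map
    by (intro ballI, elim imageE, intro image_eqI[of _ _ "(_, _)"] SigmaI)
      (auto intro!: padded assms simp del: insert_iff in_lists_conv_set)
qed

lemma regular_graph_if_finitely_spliceable:
  assumes "finite \<Sigma>" and f: "f \<in> lists \<Sigma> \<rightarrow> lists \<Sigma>" and "finitely_spliceable \<Sigma> f"
  shows "regular_language {convolution u (f u) | u. u \<in> lists \<Sigma>}"
proof -
  obtain p :: "letter list \<Rightarrow> nat \<Rightarrow> nat" where
    p: "finite {p u i | u i. u \<in> lists \<Sigma>}"
       "\<forall>u\<in>lists \<Sigma>. \<forall>v\<in>lists \<Sigma>. \<forall>i j. p u i = p v j \<longrightarrow>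
          f (take i u @ drop j v) = take i (f u) @ drop j (f v)"
    using assms(3) unfolding finitely_spliceable_def by blast
  define A where "A = (\<lambda>(a, b). Conv a b) ` (insert None (Some ` \<Sigma>) \<times> insert None (Some ` \<Sigma>))"
  define W where "W = {convolution u (f u) | u. u \<in> lists \<Sigma>}"
  \<comment> \<open>All that the set of continuations of a prefix \<open>w\<close> depends on: the possible labels of the
    cut at its end, together with the lengths needed for convolution to respect splicing.\<close>
  define \<kappa> where "\<kappa> w = {(p u (length w), length u < length w, length (f u) < length w) | u.
      u \<in> lists \<Sigma> \<and> (\<exists>z. convolution u (f u) = w @ z)}" for w
  have sub: "{z. w @ z \<in> W} \<subseteq> {z. w' @ z \<in> W}" if "\<kappa> w = \<kappa> w'" for w w'
  proof
    fix z assume "z \<in> {z. w @ z \<in> W}"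
    then obtain u where u: "u \<in> lists \<Sigma>" "w @ z = convolution u (f u)"
      by (auto simp: W_def)
    have "(p u (length w), length u < length w, length (f u) < length w) \<in> \<kappa> w"
      unfolding \<kappa>_def using u(1) u(2)[symmetric] by blast
    then have "(p u (length w), length u < length w, length (f u) < length w) \<in> \<kappa> w'"
      by (simp only: that)
    then obtain u' z' where u': "u' \<in> lists \<Sigma>" "convolution u' (f u') = w' @ z'"
      and eq': "(p u (length w), length u < length w, length (f u) < length w) =
        (p u' (length w'), length u' < length w', length (f u') < length w')"
      unfolding \<kappa>_def by blast
    then have eq: "p u' (length w') = p u (length w)"
        "length u' < length w' \<longleftrightarrow> length u < length w"
        "length (f u') < length w' \<longleftrightarrow> length (f u) < length w"
      by simp_all
    let ?v = "take (length w') u' @ drop (length w) u"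
    have "length w \<le> max (length u) (length (f u))"
      "length w' \<le> max (length u') (length (f u'))"
      using arg_cong[OF u(2), of length] arg_cong[OF u'(2), of length] by simp_all
    then have "convolution ?v (f ?v) =
        take (length w') (convolution u' (f u')) @ drop (length w) (convolution u (f u))"
      unfolding p(2)[rule_format, OF u'(1) u(1) eq(1)] using eq by (intro convolution_splice) auto
    also have "\<dots> = w' @ z"
      using u' u(2)[symmetric] by simp
    finally have "w' @ z = convolution ?v (f ?v)" ..
    moreover have "?v \<in> lists \<Sigma>"
      using u u' by (auto dest: in_set_takeD in_set_dropD)
    ultimately show "z \<in> {z. w' @ z \<in> W}"
      unfolding W_def by blast
  qed
  have "finite (\<kappa> ` lists A)"
  proof (rule finite_subset)
    show "\<kappa> ` lists A \<subseteq> Pow ({p u i | u i. u \<in> lists \<Sigma>} \<times> UNIV)"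
      by (auto simp: \<kappa>_def)
    show "finite (Pow ({p u i | u i. u \<in> lists \<Sigma>} \<times> (UNIV :: (bool \<times> bool) set)))"
      using p(1) by (simp add: finite_prod)
  qed
  moreover have "(\<lambda>w. {z. w @ z \<in> W}) ` lists A \<subseteq>
      (\<lambda>k. {z. (SOME w. \<kappa> w = k) @ z \<in> W}) ` \<kappa> ` lists A" (is "_ \<subseteq> ?h ` _")
  proof (rule image_subsetI)
    fix w assume "w \<in> lists A"
    have "\<kappa> (SOME w'. \<kappa> w' = \<kappa> w) = \<kappa> w"
      by (rule someI[of "\<lambda>w'. \<kappa> w' = \<kappa> w"]) simp
    then have "{z. w @ z \<in> W} = ?h (\<kappa> w)"
      by (intro subset_antisym sub) simp_all
    then show "{z. w @ z \<in> W} \<in> ?h ` \<kappa> ` lists A"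
      using \<open>w \<in> lists A\<close> by (intro image_eqI[OF _ imageI])
  qed
  ultimately have "finite ((\<lambda>w. {z. w @ z \<in> W}) ` lists A)"
    by (rule finite_subset[rotated, OF finite_imageI])
  moreover have "finite A"
    using assms(1) by (simp add: A_def)
  moreover have "W \<subseteq> lists A"
    unfolding W_def A_def by (intro subsetI, elim CollectE exE conjE, hypsubst)
      (intro convolution_in_lists funcset_mem[OF f])
  ultimately show ?thesis
    unfolding W_def[symmetric] by (intro regular_if_finite_derivatives)
qed

section \<open>Crossing sequences\<close>

abbreviation state_of :: "config \<Rightarrow> nat" where "state_of \<equiv> fst"
abbreviation tape_of :: "config \<Rightarrow> nat \<Rightarrow> tape_symbol" where "tape_of C \<equiv> fst (snd C)"
abbreviation head_of :: "config \<Rightarrow> nat" where "head_of C \<equiv> snd (snd C)"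

definition halted :: "pf_tm \<Rightarrow> config \<Rightarrow> bool" where
  "halted M C \<longleftrightarrow> trans M (state_of C) (tape_of C (head_of C)) = None"

text \<open>
  A halted configuration is its own successor, so that runs are total in time and become constant
  once the machine halts.
\<close>

definition next_config :: "pf_tm \<Rightarrow> config \<Rightarrow> config" where
  "next_config M C =
     (case trans M (state_of C) (tape_of C (head_of C)) of
        None \<Rightarrow> C
      | Some (q, b, m) \<Rightarrow> (q, (tape_of C)(head_of C := b), move_head m (head_of C)))"

definition run :: "pf_tm \<Rightarrow> (nat \<Rightarrow> tape_symbol) \<Rightarrow> nat \<Rightarrow> config" where
  "run M tp t = (next_config M ^^ t) (start M, tp, 0)"

text \<open>
  Boundary $b$ separates the cells $0, \dots, b$ from the rest of the tape. Since cell $0$ holds the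
  end marker, the first $b$ letters of the input lie to the left of it. The crossing sequence up to
  time $t$ records the state after each crossing. The directions alternate, starting with a
  crossing to the right.
\<close>

primrec crossings :: "pf_tm \<Rightarrow> (nat \<Rightarrow> tape_symbol) \<Rightarrow> nat \<Rightarrow> nat \<Rightarrow> nat list" where
  "crossings M tp b 0 = []"
| "crossings M tp b (Suc t) = crossings M tp b t @
     (if (head_of (run M tp t) \<le> b) = (head_of (run M tp (Suc t)) \<le> b) then []
      else [state_of (run M tp (Suc t))])"

lemma run_0 [simp]: "run M tp 0 = (start M, tp, 0)"
  by (simp add: run_def)

lemma run_Suc: "run M tp (Suc t) = next_config M (run M tp t)"
  by (simp add: run_def)

lemma tm_step_pow_run:
  "((start M, tp, 0), C) \<in> tm_step M ^^ t \<Longrightarrow> C = run M tp t"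
proof (induction t arbitrary: C)
  case (Suc t)
  then obtain B where "B = run M tp t" "(B, C) \<in> tm_step M" by auto
  then show ?case by (auto simp: run_Suc next_config_def tm_step_def)
qed auto

lemma run_halted_stable:
  assumes "halted M (run M tp t)"
  shows "run M tp (t + d) = run M tp t \<and> crossings M tp b (t + d) = crossings M tp b t"
proof (induction d)
  case (Suc d)
  then show ?case
    using assms by (auto simp: run_Suc next_config_def halted_def)
qed simp

lemma halted_unique:
  assumes "halted M (run M tp t)" "halted M (run M tp t')"
  shows "run M tp t = run M tp t' \<and> crossings M tp b t = crossings M tp b t'"
  using assms run_halted_stable by (metis linorder_le_cases le_iff_add)

lemma crossings_prefix: "t \<le> t' \<Longrightarrow> \<exists>zs. crossings M tp b t' = crossings M tp b t @ zs"
  by (induction rule: dec_induct) auto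

lemma crossings_length_halted:
  assumes "halted M (run M tp T)"
  shows "length (crossings M tp b t) \<le> length (crossings M tp b T)"
proof (cases "t \<le> T")
  case True
  then show ?thesis using crossings_prefix[of t T M tp b] by auto
next
  case False
  then show ?thesis
    using run_halted_stable[OF assms, of "t - T" b] by simp
qed

lemma head_step:
  "head_of (next_config M C) \<le> Suc (head_of C) \<and> head_of C \<le> Suc (head_of (next_config M C))"
proof -
  have "move_head m h \<le> Suc h \<and> h \<le> Suc (move_head m h)" for m h
    by (cases m) auto
  then show ?thesis by (auto simp: next_config_def split: option.split)
qed

text \<open>
  A step moves the head by at most one cell and hence crosses at most one boundary.
\<close>

lemma sum_crossings_le: "(\<Sum>b\<le>n. length (crossings M tp b t)) \<le> t"
proof (induction t)
  case (Suc t)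
  let ?h = "head_of (run M tp t)" and ?h' = "head_of (run M tp (Suc t))"
  let ?crossed = "\<lambda>b. if (?h \<le> b) = (?h' \<le> b) then 0 else 1 :: nat"
  have "?h' \<le> Suc ?h \<and> ?h \<le> Suc ?h'"
    unfolding run_Suc by (rule head_step)
  then have "?crossed b \<le> (if b = min ?h ?h' then 1 else 0)" for b
    by auto
  then have "sum ?crossed {..n} \<le> (\<Sum>b\<le>n. if b = min ?h ?h' then 1 else 0)"
    by (intro sum_mono)
  also have "\<dots> \<le> 1" by simp
  finally have le: "sum ?crossed {..n} \<le> 1" .
  have len: "length (crossings M tp b (Suc t)) = length (crossings M tp b t) + ?crossed b" for b
    by simp
  show ?case
    unfolding len sum.distrib using Suc le by linarith
qed simp

lemma run_states:
  assumes "pf_tm_wf \<Sigma> M" "range tp \<subseteq> tape_alphabet M"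
  shows "state_of (run M tp t) \<in> states M \<and> range (tape_of (run M tp t)) \<subseteq> tape_alphabet M"
proof (induction t)
  case 0
  then show ?case using assms by (auto simp: pf_tm_wf_def)
next
  case (Suc t)
  obtain q tp' h where C: "run M tp t = (q, tp', h)" by (metis prod_cases3)
  show ?case
  proof (cases "trans M q (tp' h)")
    case None
    then show ?thesis using Suc by (simp add: run_Suc next_config_def C)
  next
    case (Some a)
    obtain q' b m where a: "a = (q', b, m)" by (metis prod_cases3)
    have "q \<in> states M" "tp' h \<in> tape_alphabet M"
      using Suc C by auto
    then have "q' \<in> states M" "b \<in> tape_alphabet M"
      using assms(1) Some a unfolding pf_tm_wf_def by blast+
    then show ?thesis using Suc Some a by (auto simp: run_Suc next_config_def C)
  qed
qed

lemma crossings_states: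
  assumes "pf_tm_wf \<Sigma> M" "range tp \<subseteq> tape_alphabet M"
  shows "set (crossings M tp b t) \<subseteq> states M"
  using run_states[OF assms] by (induction t) auto

section \<open>Splicing runs\<close>

text \<open>
  Configuration $C$ looks like $A$ up to boundary $i$ and like $B$ beyond boundary $j$. The
  heads of $A$ and $B$ are on the same side, and $C$ follows the one on whose part of the tape it
  is working. The other head may be anywhere on its side, as only the idle part of its tape
  matters.
\<close>

definition spliced_config :: "nat \<Rightarrow> nat \<Rightarrow> config \<Rightarrow> config \<Rightarrow> config \<Rightarrow> bool" where
  "spliced_config i j A B C \<longleftrightarrow>
     (head_of A \<le> i \<longleftrightarrow> head_of B \<le> j) \<and>
     (if head_of A \<le> i then state_of C = state_of A \<and> head_of C = head_of A
      else state_of C = state_of B \<and> head_of C + j = head_of B + i) \<and>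
     (\<forall>c\<le>i. tape_of C c = tape_of A c) \<and>
     (\<forall>d>0. tape_of C (i + d) = tape_of B (j + d))"

lemma spliced_config_left_view:
  assumes "spliced_config i j A B C" "head_of A \<le> i"
  shows "state_of C = state_of A" "head_of C = head_of A"
    "tape_of C (head_of C) = tape_of A (head_of A)"
  using assms by (auto simp: spliced_config_def)

lemma spliced_config_right_view:
  assumes "spliced_config i j A B C" "\<not> head_of A \<le> i"
  obtains d where "d > 0" "head_of B = j + d" "head_of C = i + d" "state_of C = state_of B"
    "tape_of C (head_of C) = tape_of B (head_of B)"
proof -
  define d where "d = head_of B - j"
  have "d > 0" "head_of B = j + d" "head_of C = i + d" "state_of C = state_of B"
    using assms by (auto simp: spliced_config_def d_def)
  moreover have "tape_of C (i + d) = tape_of B (j + d)"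
    using assms(1) \<open>d > 0\<close> by (simp add: spliced_config_def)
  ultimately show ?thesis using that by auto
qed

lemma next_config_eq:
  assumes "tape_of C (head_of C) = tape_of A (head_of A)" "state_of C = state_of A"
  obtains
    (halt) "next_config M A = A" "next_config M C = C"
  | (move) q b m where
      "next_config M A = (q, (tape_of A)(head_of A := b), move_head m (head_of A))"
      "next_config M C = (q, (tape_of C)(head_of C := b), move_head m (head_of C))"
  using assms by (cases "trans M (state_of A) (tape_of A (head_of A))")
    (auto simp: next_config_def)

lemma move_head_shift: "d > 0 \<Longrightarrow> move_head m (i + d) = i + move_head m d"
  by (cases m) auto

text \<open>
  As long as the head stays on one side, $C$ moves together with the run that owns this side.
\<close>

lemma spliced_left_step:
  assumes "spliced_config i j A B C" "head_of A \<le> i"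
  shows "head_of (next_config M C) = head_of (next_config M A)"
    and "head_of (next_config M A) \<le> i \<Longrightarrow>
      spliced_config i j (next_config M A) B (next_config M C)"
  using next_config_eq[OF spliced_config_left_view(3,1)[OF assms], of M]
  by (cases; use assms in \<open>auto simp: spliced_config_def split: if_splits\<close>)+

lemma spliced_right_step:
  assumes "spliced_config i j A B C" "\<not> head_of A \<le> i"
  shows "head_of (next_config M C) + j = head_of (next_config M B) + i"
    and "\<not> head_of (next_config M B) \<le> j \<Longrightarrow>
      spliced_config i j A (next_config M B) (next_config M C)"
proof -
  obtain d where d: "d > 0" "head_of B = j + d" "head_of C = i + d" "state_of C = state_of B"
    "tape_of C (head_of C) = tape_of B (head_of B)"
    by (rule spliced_config_right_view[OF assms])
  show "head_of (next_config M C) + j = head_of (next_config M B) + i"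
    using next_config_eq[OF d(5,4), of M] by cases (auto simp: d move_head_shift)
  show "spliced_config i j A (next_config M B) (next_config M C)"
    if "\<not> head_of (next_config M B) \<le> j"
    using next_config_eq[OF d(5,4), of M]
    by cases (use assms d that in \<open>auto simp: spliced_config_def move_head_shift\<close>)
qed

lemma next_config_tape_other: "c \<noteq> head_of A \<Longrightarrow> tape_of (next_config M A) c = tape_of A c"
  by (auto simp: next_config_def split: option.split)

text \<open>
  The run that does not own the side of the heads may proceed alone, since it only changes
  cells that are invisible in $C$.
\<close>

lemma spliced_idle_left:
  assumes "spliced_config i j A B C" "head_of B \<le> j" "head_of (next_config M B) \<le> j"
  shows "spliced_config i j A (next_config M B) C"
  using assms by (auto simp: spliced_config_def next_config_tape_other)

lemma spliced_idle_right:
  assumes "spliced_config i j A B C" "\<not> head_of A \<le> i" "\<not> head_of (next_config M A) \<le> i"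
  shows "spliced_config i j (next_config M A) B C"
  using assms by (auto simp: spliced_config_def next_config_tape_other)

text \<open>
  When both runs cross in the same state, the ownership changes hands: $C$ steps with the run
  that it has followed and afterwards is in the situation of the other one.
\<close>

lemma spliced_crossing_step:
  assumes sp: "spliced_config i j A B C"
    and A: "(head_of A \<le> i) \<noteq> (head_of (next_config M A) \<le> i)"
    and B: "(head_of B \<le> j) \<noteq> (head_of (next_config M B) \<le> j)"
    and st: "state_of (next_config M A) = state_of (next_config M B)"
  shows "spliced_config i j (next_config M A) (next_config M B) (next_config M C)"
    and "head_of (next_config M C) = head_of (next_config M A)"
    and "head_of (next_config M C) + j = head_of (next_config M B) + i"
    and "head_of C = head_of A" and "head_of C + j = head_of B + i"
proof -
  have side: "head_of A \<le> i \<longleftrightarrow> head_of B \<le> j"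
    using sp by (simp add: spliced_config_def)
  have hA: "head_of (next_config M A) \<le> Suc (head_of A)" "head_of A \<le> Suc (head_of (next_config M A))"
    and hB: "head_of (next_config M B) \<le> Suc (head_of B)" "head_of B \<le> Suc (head_of (next_config M B))"
    using head_step by blast+
  have *: "spliced_config i j (next_config M A) (next_config M B) (next_config M C) \<and>
    head_of (next_config M C) = head_of (next_config M A) \<and>
    head_of (next_config M C) + j = head_of (next_config M B) + i \<and>
    head_of C = head_of A \<and> head_of C + j = head_of B + i"
  proof (cases "head_of A \<le> i")
    case True
    have h: "head_of A = i" "head_of (next_config M A) = Suc i"
      "head_of B = j" "head_of (next_config M B) = Suc j"
      using True side A B hA hB by linarith+
    show ?thesis
    proof (cases rule: next_config_eq[OF spliced_config_left_view(3,1)[OF sp True], of M, case_names halt move])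
      case halt
      then show ?thesis using h by simp
    next
      case (move q b m)
      then show ?thesis
        using sp h st by (auto simp: spliced_config_def next_config_tape_other)
    qed
  next
    case False
    have h: "head_of A = Suc i" "head_of (next_config M A) = i"
      "head_of B = Suc j" "head_of (next_config M B) = j"
      using False side A B hA hB by linarith+
    obtain d where d: "d > 0" "head_of B = j + d" "head_of C = i + d" "state_of C = state_of B"
      "tape_of C (head_of C) = tape_of B (head_of B)"
      by (rule spliced_config_right_view[OF sp False])
    show ?thesis
    proof (cases rule: next_config_eq[OF d(5,4), of M, case_names halt move])
      case halt
      then show ?thesis using h by simp
    next
      case (move q b m)
      have "move_head m d = 0"
        using move(1) h d(2) move_head_shift[OF d(1), of m j] by simp
      then show ?thesis
        using move sp h st d
        by (auto simp: spliced_config_def next_config_tape_other move_head_shift)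
    qed
  qed
  then show "spliced_config i j (next_config M A) (next_config M B) (next_config M C)"
    and "head_of (next_config M C) = head_of (next_config M A)"
    and "head_of (next_config M C) + j = head_of (next_config M B) + i"
    and "head_of C = head_of A" and "head_of C + j = head_of B + i"
    by blast+
qed


text \<open>
  The three runs are simulated together, with independent clocks. Each of the two given runs
  proceeds until its next step crosses the cut; once both are about to cross, they cross
  together. The equality of the crossing sequences guarantees that neither waits in vain and that
  both cross in the same state. The numbers of crossings at all other boundaries are
  inherited from the run that owns the boundary, which is needed for shortening an
  input without losing a long crossing sequence.
\<close>

lemma run_splice:
  assumes cross: "crossings M tp1 i T1 = crossings M tp2 j T2"
    and left: "\<And>c. c \<le> i \<Longrightarrow> tp3 c = tp1 c"
    and right: "\<And>d. d > 0 \<Longrightarrow> tp3 (i + d) = tp2 (j + d)"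
  obtains T3 where "spliced_config i j (run M tp1 T1) (run M tp2 T2) (run M tp3 T3)"
    and "\<forall>b\<le>i. length (crossings M tp3 b T3) = length (crossings M tp1 b T1)"
    and "\<forall>d. length (crossings M tp3 (i + d) T3) = length (crossings M tp2 (j + d) T2)"
proof -
  define sync where "sync t1 t2 t3 \<longleftrightarrow> t1 \<le> T1 \<and> t2 \<le> T2 \<and>
      spliced_config i j (run M tp1 t1) (run M tp2 t2) (run M tp3 t3) \<and>
      crossings M tp1 i t1 = crossings M tp2 j t2 \<and>
      (\<forall>b\<le>i. length (crossings M tp3 b t3) = length (crossings M tp1 b t1)) \<and>
      (\<forall>d. length (crossings M tp3 (i + d) t3) = length (crossings M tp2 (j + d) t2))"
    for t1 t2 t3
  have advance: "\<exists>t1' t2' t3'. sync t1' t2' t3' \<and> t1 + t2 < t1' + t2'"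
    if sync: "sync t1 t2 t3" and todo: "t1 < T1 \<or> t2 < T2" for t1 t2 t3
  proof -
    let ?A = "run M tp1 t1" and ?B = "run M tp2 t2" and ?C = "run M tp3 t3"
    let ?A' = "next_config M ?A" and ?B' = "next_config M ?B" and ?C' = "next_config M ?C"
    have sp: "spliced_config i j ?A ?B ?C"
      and eq: "crossings M tp1 i t1 = crossings M tp2 j t2"
      using sync by (simp_all add: sync_def)
    have side: "head_of ?A \<le> i \<longleftrightarrow> head_of ?B \<le> j"
      using sp by (simp add: spliced_config_def)
    define crossA where "crossA \<longleftrightarrow> (head_of ?A \<le> i) \<noteq> (head_of ?A' \<le> i)"
    define crossB where "crossB \<longleftrightarrow> (head_of ?B \<le> j) \<noteq> (head_of ?B' \<le> j)"
    have prefix1: "\<exists>zs. crossings M tp1 i T1 = crossings M tp1 i t1 @ [state_of ?A'] @ zs"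
      if "t1 < T1" crossA
      using crossings_prefix[of "Suc t1" T1 M tp1 i] that by (auto simp: run_Suc crossA_def)
    have prefix2: "\<exists>zs. crossings M tp2 j T2 = crossings M tp2 j t2 @ [state_of ?B'] @ zs"
      if "t2 < T2" crossB
      using crossings_prefix[of "Suc t2" T2 M tp2 j] that by (auto simp: run_Suc crossB_def)
    consider (A_left) "t1 < T1" "\<not> crossA" "head_of ?A \<le> i"
      | (A_right) "t1 < T1" "\<not> crossA" "\<not> head_of ?A \<le> i"
      | (B_left) "t2 < T2" "\<not> crossB" "head_of ?A \<le> i"
      | (B_right) "t2 < T2" "\<not> crossB" "\<not> head_of ?A \<le> i"
      | (cross) "t1 < T1 \<longrightarrow> crossA" "t2 < T2 \<longrightarrow> crossB"
      by blast
    then show ?thesis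
    proof cases
      case A_left
      then have "head_of ?A' \<le> i" by (simp add: crossA_def)
      have "head_of ?C = head_of ?A" "head_of ?C' = head_of ?A'"
        by (rule spliced_config_left_view(2)[OF sp A_left(3)] spliced_left_step(1)[OF sp A_left(3)])+
      then have "sync (Suc t1) t2 (Suc t3)"
        using sync A_left \<open>head_of ?A' \<le> i\<close> spliced_left_step(2)[OF sp A_left(3)]
        by (auto simp: sync_def run_Suc)
      then show ?thesis by (intro exI conjI) auto
    next
      case A_right
      then have "\<not> head_of ?A' \<le> i" by (simp add: crossA_def)
      then have "sync (Suc t1) t2 t3"
        using sync A_right spliced_idle_right[OF sp A_right(3)]
        by (auto simp: sync_def run_Suc)
      then show ?thesis by (intro exI conjI) auto
    next
      case B_left
      then have B: "head_of ?B \<le> j" "head_of ?B' \<le> j" using side by (simp_all add: crossB_def)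
      then have "sync t1 (Suc t2) t3"
        using sync B_left spliced_idle_left[OF sp B]
        by (auto simp: sync_def run_Suc)
      then show ?thesis by (intro exI conjI) auto
    next
      case B_right
      then have B: "\<not> head_of ?B \<le> j" "\<not> head_of ?B' \<le> j" using side by (simp_all add: crossB_def)
      have C: "head_of ?C + j = head_of ?B + i" "head_of ?C' + j = head_of ?B' + i"
        using sp B_right(3) spliced_right_step(1)[OF sp B_right(3)] by (auto simp: spliced_config_def)
      have "head_of ?C \<le> i + d \<longleftrightarrow> head_of ?B \<le> j + d"
        "head_of ?C' \<le> i + d \<longleftrightarrow> head_of ?B' \<le> j + d" for d
        using C by linarith+
      moreover have "\<not> head_of ?C \<le> b" "\<not> head_of ?C' \<le> b" if "b \<le> i" for b
        using that C B by linarith+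
      ultimately have "sync t1 (Suc t2) (Suc t3)"
        using sync B_right B spliced_right_step(2)[OF sp B_right(3) B(2)]
        by (auto simp: sync_def run_Suc)
      then show ?thesis by (intro exI conjI) auto
    next
      case cross
      have "t1 < T1 \<and> t2 < T2"
      proof (rule ccontr)
        assume "\<not> ?thesis"
        then consider "t1 < T1" "t2 = T2" | "t1 = T1" "t2 < T2"
          using todo sync by (auto simp: sync_def)
        then show False
          by cases (use prefix1 prefix2 cross assms(1) eq in auto)
      qed
      then have t: "t1 < T1" "t2 < T2" and crossA crossB using cross by blast+
      have A: "(head_of ?A \<le> i) \<noteq> (head_of ?A' \<le> i)" and B: "(head_of ?B \<le> j) \<noteq> (head_of ?B' \<le> j)"
        using \<open>crossA\<close> \<open>crossB\<close> by (simp_all add: crossA_def crossB_def)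
      have st: "state_of ?A' = state_of ?B'"
        using prefix1[OF t(1) \<open>crossA\<close>] prefix2[OF t(2) \<open>crossB\<close>] assms(1) eq by auto
      note step = spliced_crossing_step[OF sp A B st]
      have "head_of ?C \<le> i + d \<longleftrightarrow> head_of ?B \<le> j + d"
        "head_of ?C' \<le> i + d \<longleftrightarrow> head_of ?B' \<le> j + d" for d
        using step(3,5) by linarith+
      then have "sync (Suc t1) (Suc t2) (Suc t3)"
        using sync t A B st step(1,2,4) by (simp add: sync_def run_Suc)
      then show ?thesis by (intro exI conjI) auto
    qed
  qed
  have finish: "\<exists>T3. sync T1 T2 T3" if "sync t1 t2 t3" for t1 t2 t3
    using that
  proof (induction "T1 + T2 - (t1 + t2)" arbitrary: t1 t2 t3 rule: less_induct)
    case less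
    show ?case
    proof (cases "t1 < T1 \<or> t2 < T2")
      case True
      then obtain t1' t2' t3' where *: "sync t1' t2' t3'" "t1 + t2 < t1' + t2'"
        using advance less.prems by blast
      then have "T1 + T2 - (t1' + t2') < T1 + T2 - (t1 + t2)"
        by (auto simp: sync_def)
      then show ?thesis using less.hyps * by blast
    next
      case False
      then have "t1 = T1" "t2 = T2" using less.prems by (auto simp: sync_def)
      then show ?thesis using less.prems by blast
    qed
  qed
  have "sync 0 0 0"
    using left right by (auto simp: sync_def spliced_config_def)
  then obtain T3 where "sync T1 T2 T3"
    using finish by blast
  then show ?thesis
    by (intro that[of T3]) (simp_all add: sync_def)
qed

lemma spliced_config_halted:
  assumes "spliced_config i j A B C" "halted M A" "halted M B"
  shows "halted M C"
proof (cases "head_of A \<le> i")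
  case True
  then show ?thesis
    using spliced_config_left_view[OF assms(1) True] assms(2) by (simp add: halted_def)
next
  case False
  show ?thesis
    by (rule spliced_config_right_view[OF assms(1) False]) (use assms(3) in \<open>simp add: halted_def\<close>)
qed

lemma initial_tape_splice:
  assumes "length x < i \<longleftrightarrow> length y < j"
  shows "c \<le> i \<Longrightarrow> initial_tape (take i x @ drop j y) c = initial_tape x c"
    and "d > 0 \<Longrightarrow> initial_tape (take i x @ drop j y) (i + d) = initial_tape y (j + d)"
  using assms by (auto simp: initial_tape_def nth_append min_def)

section \<open>Crossing sequences of linear-time machines\<close>

lemma initial_tape_alphabet:
  assumes wf: "pf_tm_wf \<Sigma> M" and x: "x \<in> lists \<Sigma>"
  shows "range (initial_tape x) \<subseteq> tape_alphabet M"
proof -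
  have "{Left_End, Blank} \<union> Letter ` \<Sigma> \<subseteq> tape_alphabet M"
    using wf by (simp only: pf_tm_wf_def)
  moreover have "initial_tape x k \<in> {Left_End, Blank} \<union> Letter ` \<Sigma>" for k
    using x by (auto simp: initial_tape_def)
  ultimately show ?thesis by blast
qed

text \<open>
  Hennie's theorem. A run of at most $c(n+1)$ steps has a crossing sequence of length at most $2c$ at
  half or more of the boundaries $0, \dots, n$ of the input. There are boundedly many such
  sequences, so if the input is long and $b$ is a boundary with more than $2c$ crossings, two of these
  boundaries $i < j$ have the same one and lie on the same side of $b$. Cutting out the segment between
  them shortens the input and preserves the number of crossings at $b$. Hence every number of
  crossings above $2c$ already occurs on an input of bounded length, where the running time bounds it.
\<close>

lemma crossings_bounded_if_linear_time:
  assumes wf: "pf_tm_wf \<Sigma> M"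
    and time: "\<forall>x\<in>lists \<Sigma>. \<exists>t\<le>c * (length x + 1). halted M (run M (initial_tape x) t)"
  shows "\<exists>K. \<forall>x\<in>lists \<Sigma>. \<forall>b t. length (crossings M (initial_tape x) b t) \<le> K"
proof -
  define Short where "Short = {xs. set xs \<subseteq> states M \<and> length xs \<le> 2 * c}"
  have fin: "finite (Short \<times> (UNIV :: bool set))"
    unfolding Short_def using wf finite_lists_length_le[of "states M" "2 * c"]
    by (simp add: pf_tm_wf_def)
  define m where "m = card (Short \<times> (UNIV :: bool set))"
  \<comment> \<open>The first summand bounds the running time on inputs too short for the pigeonhole
    argument below, the second one the crossing sequences that are short by definition.\<close>
  define K where "K = c * (2 * m + 2) + 2 * c"
  note alphabet = initial_tape_alphabet[OF wf]
  have "length (crossings M (initial_tape x) b t) \<le> K" if "x \<in> lists \<Sigma>" for x b t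
    using that
  proof (induction "length x" arbitrary: x b t rule: less_induct)
    case less
    let ?cr = "crossings M (initial_tape x)"
    define n where "n = length x"
    obtain T where T: "T \<le> c * (n + 1)" "halted M (run M (initial_tape x) T)"
      using time less.prems by (auto simp: n_def)
    have "length (?cr b T) \<le> K"
    proof (rule ccontr)
      assume long: "\<not> length (?cr b T) \<le> K"
      have "length (?cr b T) \<le> (\<Sum>b'\<le>b. length (?cr b' T))"
        by (rule member_le_sum) auto
      also have "\<dots> \<le> T" by (rule sum_crossings_le)
      also have "\<dots> \<le> c * (n + 1)" by (rule T(1))
      finally have "\<not> n + 1 \<le> 2 * m + 2"
        using long mult_le_mono2[of "n + 1" "2 * m + 2" c] by (auto simp: K_def)
      define Bad where "Bad = {b\<in>{..n}. 2 * c < length (?cr b T)}"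
      define Good where "Good = {b\<in>{..n}. length (?cr b T) \<le> 2 * c}"
      have "(2 * c + 1) * card Bad = (\<Sum>b\<in>Bad. 2 * c + 1)"
        by simp
      also have "\<dots> \<le> (\<Sum>b\<in>Bad. length (?cr b T))"
        by (rule sum_mono) (simp add: Bad_def)
      also have "\<dots> \<le> (\<Sum>b\<le>n. length (?cr b T))"
        by (rule sum_mono2) (auto simp: Bad_def)
      also have "\<dots> \<le> T" by (rule sum_crossings_le)
      also have "\<dots> \<le> c * (n + 1)" by (rule T(1))
      finally have bad: "(2 * c + 1) * card Bad \<le> c * (n + 1)" .
      have "2 * card Bad \<le> n + 1"
      proof (rule ccontr)
        assume "\<not> ?thesis"
        then have "n + 2 \<le> 2 * card Bad" by simp
        then have "(2 * c + 1) * (n + 2) \<le> 2 * ((2 * c + 1) * card Bad)"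
          using mult_le_mono2[of "n + 2" "2 * card Bad" "2 * c + 1"] by (simp add: mult.left_commute)
        then show False using bad by (simp add: algebra_simps)
      qed
      moreover have "card Good + card Bad = n + 1"
      proof -
        have "card (Good \<union> Bad) = card Good + card Bad"
          by (rule card_Un_disjoint) (auto simp: Good_def Bad_def)
        moreover have "Good \<union> Bad = {..n}" by (auto simp: Good_def Bad_def)
        ultimately show ?thesis by simp
      qed
      ultimately have "m < card Good"
        using \<open>\<not> n + 1 \<le> 2 * m + 2\<close> by linarith
      moreover have "(\<lambda>b'. (?cr b' T, b' < b)) ` Good \<subseteq> Short \<times> UNIV"
        using crossings_states[OF wf alphabet[OF less.prems]] by (auto simp: Good_def Short_def)
      ultimately have "\<not> inj_on (\<lambda>b'. (?cr b' T, b' < b)) Good"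
        using card_inj_on_le[OF _ _ fin, of "\<lambda>b'. (?cr b' T, b' < b)" Good]
        unfolding m_def by linarith
      then have "\<exists>i\<in>Good. \<exists>j\<in>Good. i < j \<and> (?cr i T, i < b) = (?cr j T, j < b)"
        unfolding inj_on_def by (metis linorder_neqE_nat)
      then obtain i j where ij:
        "i \<in> Good" "j \<in> Good" "i < j" "?cr i T = ?cr j T" "i < b \<longleftrightarrow> j < b"
        by auto
      have le: "i \<le> n" "j \<le> n"
        using ij by (auto simp: Good_def)
      define y where "y = take i x @ drop j x"
      have y: "y \<in> lists \<Sigma>" "length y < length x"
        using less.prems ij(3) le by (auto simp: y_def n_def dest: in_set_takeD in_set_dropD)
      have "length x < i \<longleftrightarrow> length x < j" using le by (simp add: n_def)
      note tape = initial_tape_splice[OF this, folded y_def]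
      obtain T3 where T3:
        "\<forall>b\<le>i. length (crossings M (initial_tape y) b T3) = length (?cr b T)"
        "\<forall>d. length (crossings M (initial_tape y) (i + d) T3) = length (?cr (j + d) T)"
        by (rule run_splice[OF ij(4) tape]) blast
      have "\<exists>b'. length (crossings M (initial_tape y) b' T3) = length (?cr b T)"
      proof (cases "j < b")
        case True
        then show ?thesis using T3(2)[rule_format, of "b - j"] by auto
      next
        case False
        then show ?thesis using T3(1)[rule_format, of b] ij(5) False by (intro exI[of _ b]) auto
      qed
      then show False
        using less.hyps[OF y(2,1)] long by metis
    qed
    then show ?case
      using crossings_length_halted[OF T(2), of b t] by linarith
  qed
  then show ?thesis by blast
qed

section \<open>Functions computed by linear-time machines\<close>

text \<open>
  The bound on the cells includes the blank that terminates the word; the rest of the tape is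
  arbitrary.
\<close>

definition holds_word :: "(nat \<Rightarrow> tape_symbol) \<Rightarrow> letter list \<Rightarrow> bool" where
  "holds_word tp y \<longleftrightarrow> (\<forall>c\<le>Suc (length y). tp c = initial_tape y c)"

lemma accepts_with_output_run:
  assumes "accepts_with_output M x t y"
  shows "halted M (run M (initial_tape x) t) \<and> holds_word (tape_of (run M (initial_tape x) t)) y"
proof -
  obtain q tp h where run: "((start M, initial_tape x, 0), (q, tp, h)) \<in> tm_step M ^^ t"
    and halt: "trans M q (tp h) = None"
    and out: "map tp [0..<length y + 2] = Left_End # map Letter y @ [Blank]"
    using assms by (auto simp: accepts_with_output_def)
  have "tp c = initial_tape y c" if "c \<le> Suc (length y)" for c
  proof -
    have "tp c = map tp [0..<length y + 2] ! c"
      using that by (simp add: nth_append del: upt_Suc)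
    then show ?thesis
      unfolding out using that by (cases c) (auto simp: initial_tape_def nth_append)
  qed
  then show ?thesis
    using halt by (simp add: halted_def holds_word_def flip: tm_step_pow_run[OF run])
qed

lemma holds_word_unique:
  assumes y: "holds_word tp y" and y': "holds_word tp y'"
  shows "y = y'"
proof -
  have le: "length z' \<le> length z" if "holds_word tp z" "holds_word tp z'" for z z'
  proof (rule ccontr)
    assume "\<not> length z' \<le> length z"
    then have "tp (Suc (length z)) = Letter (z' ! length z)"
      using that(2) by (auto simp: holds_word_def initial_tape_def)
    moreover have "tp (Suc (length z)) = Blank"
      using that(1) by (auto simp: holds_word_def initial_tape_def)
    ultimately show False by simp
  qed
  then have len: "length y = length y'"
    using assms by (intro antisym) auto
  show ?thesis
  proof (rule nth_equalityI[OF len])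
    fix k assume k: "k < length y"
    have "tp (Suc k) = Letter (y ! k)"
      using k y by (auto simp: holds_word_def initial_tape_def)
    moreover have "tp (Suc k) = Letter (y' ! k)"
      using k len y' by (auto simp: holds_word_def initial_tape_def)
    ultimately show "y ! k = y' ! k" by simp
  qed
qed

text \<open>
  The blank that ends the output lies to the left of the cut in both tapes or in neither,
  so garbage beyond it never becomes part of the spliced output.
\<close>

lemma holds_word_splice:
  assumes len: "length y < i \<longleftrightarrow> length y' < j"
    and "holds_word tp1 y" "holds_word tp2 y'"
    and left: "\<And>c. c \<le> i \<Longrightarrow> tp3 c = tp1 c"
    and right: "\<And>d. d > 0 \<Longrightarrow> tp3 (i + d) = tp2 (j + d)"
  shows "holds_word tp3 (take i y @ drop j y')"
  unfolding holds_word_def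
proof (intro allI impI)
  fix c assume c: "c \<le> Suc (length (take i y @ drop j y'))"
  show "tp3 c = initial_tape (take i y @ drop j y') c"
  proof (cases "c \<le> i")
    case True
    then have "c \<le> Suc (length y)"
      using c len by (auto simp: min_def split: if_splits)
    then show ?thesis
      using True assms(2) left initial_tape_splice(1)[OF len] by (simp add: holds_word_def)
  next
    case False
    define d where "d = c - i"
    have d: "c = i + d" "d > 0" using False by (auto simp: d_def)
    then have "j + d \<le> Suc (length y')"
      using c len by (auto simp: min_def split: if_splits)
    then show ?thesis
      using d assms(3) right initial_tape_splice(2)[OF len] by (simp add: holds_word_def)
  qed
qed

lemma finitely_spliceable_if_pf_linear_time_computable:
  assumes "pf_linear_time_computable \<Sigma> f"
  shows "finitely_spliceable \<Sigma> f"
proof -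
  obtain M c where wf: "pf_tm_wf \<Sigma> M"
    and acc: "\<forall>x\<in>lists \<Sigma>. \<exists>t\<le>c * (length x + 1). accepts_with_output M x t (f x)"
    using assms unfolding pf_linear_time_computable_def by blast
  let ?run = "\<lambda>x. run M (initial_tape x)" and ?cr = "\<lambda>x. crossings M (initial_tape x)"
  have time: "\<forall>x\<in>lists \<Sigma>. \<exists>t\<le>c * (length x + 1). halted M (?run x t)"
    using acc accepts_with_output_run by blast
  obtain K where K: "\<forall>x\<in>lists \<Sigma>. \<forall>b t. length (?cr x b t) \<le> K"
    using crossings_bounded_if_linear_time[OF wf time] by blast
  have "\<forall>x\<in>lists \<Sigma>. \<exists>t. halted M (?run x t) \<and> holds_word (tape_of (?run x t)) (f x)"
    using acc accepts_with_output_run by blast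
  then obtain T where
    T: "\<forall>x\<in>lists \<Sigma>. halted M (?run x (T x)) \<and> holds_word (tape_of (?run x (T x))) (f x)"
    by (rule bchoice[THEN exE])
  note alphabet = initial_tape_alphabet[OF wf]
  define P where
    "P = {xs. set xs \<subseteq> states M \<and> length xs \<le> K} \<times> (UNIV :: (bool \<times> bool) set)"
  show ?thesis
  proof (rule finitely_spliceableI)
    show "finite P"
      using wf finite_lists_length_le[of "states M" K]
      by (simp add: P_def pf_tm_wf_def finite_prod)
    show "(?cr u i (T u), length u < i, length (f u) < i) \<in> P" if "u \<in> lists \<Sigma>" for u i
      using crossings_states[OF wf alphabet[OF that]] K[rule_format, OF that] by (simp add: P_def)
  next
    fix u v i j
    assume u: "u \<in> lists \<Sigma>" and v: "v \<in> lists \<Sigma>"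
      and "(?cr u i (T u), length u < i, length (f u) < i) =
        (?cr v j (T v), length v < j, length (f v) < j)"
    then have cr: "?cr u i (T u) = ?cr v j (T v)" and len: "length u < i \<longleftrightarrow> length v < j"
      and lenf: "length (f u) < i \<longleftrightarrow> length (f v) < j"
      by simp_all
    define w where "w = take i u @ drop j v"
    have w: "w \<in> lists \<Sigma>"
      using u v by (auto simp: w_def dest: in_set_takeD in_set_dropD)
    obtain T3 where
      T3: "spliced_config i j (?run u (T u)) (?run v (T v)) (?run w T3)"
      by (rule run_splice[OF cr initial_tape_splice[OF len, folded w_def]]) blast
    have "halted M (?run w T3)"
      using spliced_config_halted[OF T3] T u v by blast
    then have "?run w T3 = ?run w (T w)"
      using halted_unique T w by blast
    moreover have "holds_word (tape_of (?run w T3)) (take i (f u) @ drop j (f v))"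
      by (rule holds_word_splice[OF lenf, of "tape_of (?run u (T u))" "tape_of (?run v (T v))"])
        (use T u v T3 in \<open>auto simp: spliced_config_def simp del: in_lists_conv_set\<close>)
    ultimately have "holds_word (tape_of (?run w (T w))) (take i (f u) @ drop j (f v))"
      by simp
    then show "f (take i u @ drop j v) = take i (f u) @ drop j (f v)"
      using holds_word_unique T w unfolding w_def by blast
  qed
qed

section \<open>Multiplication by a group element\<close>

theorem theorem8:
  fixes \<C> :: "letter list set set" and G :: "('g, 'b) monoid_scheme"
  assumes "language_class \<C>"
    and "\<And>\<Sigma> L. finite \<Sigma> \<Longrightarrow> L \<subseteq> lists \<Sigma> \<Longrightarrow> L \<in> \<C> \<Longrightarrow>
           {convolution u v | u v. u \<in> L \<and> v \<in> lists \<Sigma>} \<in> \<C>"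
    and "\<And>R L. regular_language R \<Longrightarrow> L \<in> \<C> \<Longrightarrow> R \<inter> L \<in> \<C>"
    and "group G"
    and "cayley_pf_linear_time_computable \<C> G"
  shows "\<exists>\<Sigma>. finite \<Sigma> \<and>
           (\<forall>S. finite S \<and> symmetric_generating_set G S \<longrightarrow> graph_automatic \<C> G S \<Sigma>)"
proof -
  interpret group G by fact
  obtain T \<Sigma> L \<psi> f where T: "semigroup_generators G T" and \<Sigma>: "finite \<Sigma>"
    and L: "L \<subseteq> lists \<Sigma>" "L \<in> \<C>" and \<psi>: "bij_betw \<psi> L (carrier G)"
    and f: "\<forall>t\<in>T. pf_linear_time_computable \<Sigma> (f t) \<and> f t ` L \<subseteq> L \<and>
      (\<forall>w\<in>L. \<psi> (f t w) = \<psi> w \<otimes>\<^bsub>G\<^esub> t)"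
    using assms(5) unfolding cayley_pf_linear_time_computable_def
    by (elim exE conjE) (rule that; assumption)
  have TG: "T \<subseteq> carrier G"
    using T by (simp add: semigroup_generators_def)
  have \<psi>G: "\<psi> w \<in> carrier G" if "w \<in> L" for w
    using \<psi> that by (auto dest: bij_betwE)
  have prodG: "foldr (mult G) ts \<one>\<^bsub>G\<^esub> \<in> carrier G" if "set ts \<subseteq> T" for ts
    using that TG by (induction ts) auto
  \<comment> \<open>The generator next to \<open>\<psi> w\<close> acts first, so its function is applied first.\<close>
  have mult: "\<exists>g. finitely_spliceable \<Sigma> g \<and> g \<in> lists \<Sigma> \<rightarrow> lists \<Sigma> \<and> g \<in> L \<rightarrow> L \<and>
      (\<forall>w\<in>L. \<psi> (g w) = \<psi> w \<otimes>\<^bsub>G\<^esub> foldr (mult G) ts \<one>\<^bsub>G\<^esub>)" if "set ts \<subseteq> T" for ts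
    using that
  proof (induction ts)
    case Nil
    show ?case
      using finitely_spliceable_id \<psi>G by (intro exI[of _ "\<lambda>w. w"]) auto
  next
    case (Cons t ts)
    then obtain g where g: "finitely_spliceable \<Sigma> g" "g \<in> lists \<Sigma> \<rightarrow> lists \<Sigma>" "g \<in> L \<rightarrow> L"
      "\<forall>w\<in>L. \<psi> (g w) = \<psi> w \<otimes>\<^bsub>G\<^esub> foldr (mult G) ts \<one>\<^bsub>G\<^esub>"
      by auto
    have t: "t \<in> T" "t \<in> carrier G" and ts: "foldr (mult G) ts \<one>\<^bsub>G\<^esub> \<in> carrier G"
      using Cons.prems TG prodG by auto
    have ft: "finitely_spliceable \<Sigma> (f t)" "f t \<in> lists \<Sigma> \<rightarrow> lists \<Sigma>" "f t \<in> L \<rightarrow> L"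
      "\<forall>w\<in>L. \<psi> (f t w) = \<psi> w \<otimes>\<^bsub>G\<^esub> t"
      using f t(1) finitely_spliceable_if_pf_linear_time_computable
      by (blast, auto simp: pf_linear_time_computable_def)
    show ?case
    proof (intro exI[of _ "\<lambda>w. g (f t w)"] conjI ballI)
      show "finitely_spliceable \<Sigma> (\<lambda>w. g (f t w))"
        by (rule finitely_spliceable_compose[OF ft(1) g(1) ft(2)])
      show "(\<lambda>w. g (f t w)) \<in> lists \<Sigma> \<rightarrow> lists \<Sigma>" "(\<lambda>w. g (f t w)) \<in> L \<rightarrow> L"
        using ft(2,3) g(2,3) by blast+
      fix w assume "w \<in> L"
      then have "f t w \<in> L" using ft(3) by blast
      then show "\<psi> (g (f t w)) = \<psi> w \<otimes>\<^bsub>G\<^esub> foldr (mult G) (t # ts) \<one>\<^bsub>G\<^esub>"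
        using \<open>w \<in> L\<close> ft(4) g(4) t(2) ts \<psi>G by (simp add: m_assoc)
    qed
  qed
  have edge: "{convolution u v | u v. u \<in> L \<and> v \<in> L \<and> \<psi> u \<otimes>\<^bsub>G\<^esub> s = \<psi> v} \<in> \<C>"
    if s: "s \<in> carrier G" for s
  proof -
    obtain ts where ts: "set ts \<subseteq> T" "s = foldr (mult G) ts \<one>\<^bsub>G\<^esub>"
      using T s unfolding semigroup_generators_def by blast
    obtain g where g: "finitely_spliceable \<Sigma> g" "g \<in> lists \<Sigma> \<rightarrow> lists \<Sigma>" "g \<in> L \<rightarrow> L"
      "\<forall>w\<in>L. \<psi> (g w) = \<psi> w \<otimes>\<^bsub>G\<^esub> s"
      using mult[OF ts(1)] unfolding ts(2) by blast
    have "\<psi> u \<otimes>\<^bsub>G\<^esub> s = \<psi> v \<longleftrightarrow> v = g u" if "u \<in> L" "v \<in> L" for u v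
    proof -
      have "g u \<in> L" using g(3) that(1) by blast
      then show ?thesis
        using g(4) that \<psi> by (metis bij_betw_imp_inj_on inj_onD)
    qed
    then have "{convolution u v | u v. u \<in> L \<and> v \<in> L \<and> \<psi> u \<otimes>\<^bsub>G\<^esub> s = \<psi> v} =
        {convolution u (g u) | u. u \<in> L}"
      using g(3) by blast
    also have "\<dots> = {convolution u (g u) | u. u \<in> lists \<Sigma>} \<inter>
        {convolution u v | u v. u \<in> L \<and> v \<in> lists \<Sigma>}"
    proof (intro subset_antisym subsetI)
      fix w assume "w \<in> {convolution u (g u) | u. u \<in> L}"
      then show "w \<in> {convolution u (g u) | u. u \<in> lists \<Sigma>} \<inter>
          {convolution u v | u v. u \<in> L \<and> v \<in> lists \<Sigma>}"
        using L(1) g(2) by blast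
    next
      fix w assume "w \<in> {convolution u (g u) | u. u \<in> lists \<Sigma>} \<inter>
          {convolution u v | u v. u \<in> L \<and> v \<in> lists \<Sigma>}"
      then obtain u u' v where w: "w = convolution u (g u)" "w = convolution u' v" "u' \<in> L"
        by blast
      then have "u = u'"
        using convolution_inject[of u "g u" u' v] by simp
      then show "w \<in> {convolution u (g u) | u. u \<in> L}"
        using w by blast
    qed
    also have "\<dots> \<in> \<C>"
      by (rule assms(3)[OF regular_graph_if_finitely_spliceable[OF \<Sigma> g(2,1)] assms(2)[OF \<Sigma> L]])
    finally show ?thesis .
  qed
  show ?thesis
  proof (intro exI[of _ \<Sigma>] conjI allI impI \<Sigma>)
    fix S assume S: "finite S \<and> symmetric_generating_set G S"
    then have "\<forall>s\<in>S. {convolution u v | u v. u \<in> L \<and> v \<in> L \<and> \<psi> u \<otimes>\<^bsub>G\<^esub> s = \<psi> v} \<in> \<C>"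
      using edge by (auto simp: symmetric_generating_set_def)
    then show "graph_automatic \<C> G S \<Sigma>"
      unfolding graph_automatic_def using \<Sigma> L \<psi> S assms(4)
      by (intro conjI exI[of _ L] exI[of _ \<psi>]) simp_all
  qed
qed

end
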